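(* Let $m\ge0$ and let $\mathbf{w}(t)=\sum_{k=0}^m\mathbf{c}_kL_k(t)=\sum_{k=0}^m\mathbf{w}_k b_k^m(t)$ be a complex pre-image polynomial with Legendre coefficient vector $\mathbf{C}=(\mathbf{c}_0,\dots,\mathbf{c}_m)^T$ and Bernstein coefficient vector $\mathbf{W}=(\mathbf{w}_0,\dots,\mathbf{w}_m)^T$ in $\mathbb{C}^{m+1}$, so that $\mathbf{W}=M_m\mathbf{C}$. Let $\mathbf{r}(t)=\int_0^t\mathbf{w}^2(\tau)\,d\tau$ and $G_m=(M_m^{-1})^TM_m^{-1}$. Then the following are equivalent: (a) $\mathbf{r}(1)=1$; (b) $\sum_{k=0}^m\mathbf{c}_k^2=1$; (c) writing $\mathbf{C}=\mathbf{C}_R+\mathrm{i}\,\mathbf{C}_I$ with $\mathbf{C}_R,\mathbf{C}_I\in\mathbb{R}^{m+1}$, $\|\mathbf{C}_R\|_2^2-\|\mathbf{C}_I\|_2^2=1$ and $\mathbf{C}_R^T\mathbf{C}_I=0$; (d) $\mathbf{W}^TG_m\mathbf{W}=1$. Moreover, suppose $\mathbf{r}(1)=1$, and let $\delta\mathbf{w}(t)=\sum_{k=0}^m\delta\mathbf{c}_kL_k(t)=\sum_{k=0}^m\delta\mathbf{w}_kb_k^m(t)$ be a complex perturbation polynomial with coefficient vectors $\delta\mathbf{C}=\delta\mathbf{C}_R+\mathrm{i}\,\delta\mathbf{C}_I$ ($\delta\mathbf{C}_R,\delta\mathbf{C}_I\in\mathbb{R}^{m+1}$) and $\delta\mathbf{W}$.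 Then the perturbed curve $\tilde{\mathbf{r}}(t)=\int_0^t(\mathbf{w}(\tau)+\delta\mathbf{w}(\tau))^2\,d\tau$ satisfies $\tilde{\mathbf{r}}(1)=1$ if and only if $\delta\mathbf{C}^T(\delta\mathbf{C}+2\mathbf{C})=0$, equivalently $\delta\mathbf{W}^TG_m(\delta\mathbf{W}+2\mathbf{W})=0$, equivalently $$\|\delta\mathbf{C}_R\|_2^2-\|\delta\mathbf{C}_I\|_2^2+2\,\delta\mathbf{C}_R^T\mathbf{C}_R-2\,\delta\mathbf{C}_I^T\mathbf{C}_I=0\quad\text{and}\quad\delta\mathbf{C}_R^T\delta\mathbf{C}_I+\delta\mathbf{C}_R^T\mathbf{C}_I+\delta\mathbf{C}_I^T\mathbf{C}_R=0.$$
   Context: Points of the plane are identified with complex numbers. $b_k^m(t)=\binom{m}{k}(1-t)^{m-k}t^k$ is the Bernstein basis. $L_k$ are the real orthonormal Legendre polynomials on $[0,1]$: $L_k(t)=\sqrt{2k+1}\sum_{i=0}^k(-1)^{k+i}\binom{k}{i}b_i^k(t)$, satisfying $\int_0^1L_jL_k\,dt=\delta_{jk}$. $M_m$ is the invertible real $(m+1)\times(m+1)$ matrix converting Legendre coefficients to Bernstein coefficients of degree $m$: if $\sum_kc_kL_k=\sum_jd_jb_j^m$ then $(d_0,\dots,d_m)^T=M_m(c_0,\dots,c_m)^T$. The superscript $T$ denotes transpose without complex conjugation, and $\|\cdot\|_2$ of a real vector is the Euclidean norm. *)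

theory Defs
  imports
    "HOL-Analysis.Analysis"
    "Jordan_Normal_Form.Determinant"
    "Jordan_Normal_Form.Gauss_Jordan_Elimination"
begin

unbundle no inner_syntax
unbundle no vec_syntax

text \<open>The Bernstein basis element \<open>b\<^sub>k\<^sup>m\<close> is the library's \<^term>\<open>Bernstein m k\<close>.\<close>

definition legendre :: "nat \<Rightarrow> real \<Rightarrow> real" where
  "legendre k t = sqrt (2 * real k + 1) *
     (\<Sum>i\<le>k. (-1) ^ (k + i) * real (k choose i) * Bernstein k i t)"

text \<open>Vectors in dimension \<open>m + 1\<close> are indexed by \<open>0, \<dots>, m\<close>. The scalar type is
  left open since both real and complex coefficients occur.\<close>

definition legendre_sum :: "nat \<Rightarrow> 'a::real_vector vec \<Rightarrow> real \<Rightarrow> 'a" where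
  "legendre_sum m c t = (\<Sum>k\<le>m. legendre k t *\<^sub>R (c $ k))"

definition bernstein_sum :: "nat \<Rightarrow> 'a::real_vector vec \<Rightarrow> real \<Rightarrow> 'a" where
  "bernstein_sum m d t = (\<Sum>k\<le>m. Bernstein m k t *\<^sub>R (d $ k))"

definition is_legendre_bernstein_mat :: "nat \<Rightarrow> real mat \<Rightarrow> bool" where
  "is_legendre_bernstein_mat m M \<longleftrightarrow>
     M \<in> carrier_mat (m + 1) (m + 1) \<and> invertible_mat M \<and>
     (\<forall>c \<in> carrier_vec (m + 1). \<forall>d \<in> carrier_vec (m + 1).
        (\<forall>t. legendre_sum m c t = bernstein_sum m d t) \<longrightarrow> d = M *\<^sub>v c)"

lemma power_bern: assumes "k \<le> m"
  shows "(t::real)^k = (\<Sum>j\<le>m. real (j choose k) / real (m choose k) * Bernstein m j t)"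
proof -
  have mk: "real (m choose k) \<noteq> 0" using assms by simp
  have "(\<Sum>j\<le>m. real (j choose k) / real (m choose k) * Bernstein m j t)
    = (\<Sum>j\<in>{k..m}. real (j choose k) / real (m choose k) * Bernstein m j t)"
    by (rule sum.mono_neutral_right) auto
  also have "\<dots> = (\<Sum>j\<in>{k..m}. real ((m-k) choose (j-k)) * t^j * (1-t)^(m-j))"
  proof (rule sum.cong[OF refl])
    fix j assume j: "j \<in> {k..m}"
    have "real (m choose j) * real (j choose k) = real (m choose k) * real ((m-k) choose (j-k))"
      using choose_mult[of k j m] j by (metis atLeastAtMost_iff of_nat_mult)
    then have "real (j choose k) / real (m choose k) * real (m choose j) = real ((m-k) choose (j-k))"
      using mk by (simp add: field_simps)
    then show "real (j choose k) / real (m choose k) * Bernstein m j t = real ((m-k) choose (j-k)) * t^j * (1-t)^(m-j)"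
      unfolding Bernstein_def by (simp add: mult.assoc[symmetric])
  qed
  also have "\<dots> = (\<Sum>i\<le>m-k. real ((m-k) choose i) * t^(i+k) * (1-t)^(m-k-i))"
    using assms by (intro sum.reindex_bij_witness[of _ "\<lambda>i. i+k" "\<lambda>j. j-k"]) auto
  also have "\<dots> = t^k * (\<Sum>i\<le>m-k. real ((m-k) choose i) * t^i * (1-t)^(m-k-i))"
    by (simp add: sum_distrib_left power_add mult_ac)
  also have "\<dots> = t^k * (t + (1-t))^(m-k)"
    by (subst binomial_ring) simp
  finally show ?thesis by simp
qed

lemma bern_indep: fixes d :: "nat \<Rightarrow> real"
  assumes "\<And>t. (\<Sum>j\<le>m. d j * Bernstein m j t) = 0" and "j \<le> m"
  shows "d j = 0"
proof -
  let ?c = "\<lambda>j. d j * real (m choose j)"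
  have z: "(\<Sum>j\<le>m. ?c j * x^j) = 0" if "x > 0" for x::real
  proof -
    have "0 = (1+x)^m * (\<Sum>j\<le>m. d j * Bernstein m j (x/(1+x)))" using assms by simp
    also have "\<dots> = (\<Sum>j\<le>m. ?c j * x^j)"
      unfolding sum_distrib_left
    proof (rule sum.cong[OF refl])
      fix j assume "j \<in> {..m}"
      then have e: "(1+x)^m = (1+x)^j * (1+x)^(m-j)" by (simp flip: power_add)
      have f: "1 - x/(1+x) = 1/(1+x)" using that by (simp add: field_simps)
      show "(1+x)^m * (d j * Bernstein m j (x/(1+x))) = ?c j * x^j"
        unfolding Bernstein_def e f using that by (simp add: power_divide)
    qed
    finally show ?thesis by simp
  qed
  have "?c j = 0"
  proof (rule ccontr)
    assume "?c j \<noteq> 0"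
    then have "finite {x. (\<Sum>i\<le>m. ?c i * x^i) = 0}"
      using polyfun_roots_finite[of ?c j m] assms(2) by simp
    moreover have "{0<..} \<subseteq> {x. (\<Sum>i\<le>m. ?c i * x^i) = 0}" using z by auto
    ultimately show False using infinite_Ioi finite_subset by blast
  qed
  then show ?thesis using assms(2) by simp
qed

lemma legendre_monom:
  obtains a :: "nat \<Rightarrow> real" where "\<And>t. legendre k t = (\<Sum>i\<le>k. a i * t^i)" "a k \<noteq> 0"
proof -
  define q :: "nat \<Rightarrow> real poly" where "q i = [:0,1:]^i * [:1,-1:]^(k-i)" for i
  have dq: "degree (q i) = k" if "i \<le> k" for i
    unfolding q_def using that by (simp add: degree_mult_eq degree_power_eq)
  have lq: "coeff (q i) k = (-1)^(k-i)" if "i \<le> k" for i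
  proof -
    have "coeff (q i) k = lead_coeff (q i)" using dq[OF that] by simp
    also have "\<dots> = (-1)^(k-i)" unfolding q_def by (simp add: lead_coeff_mult lead_coeff_power)
    finally show ?thesis .
  qed
  define p where "p = Polynomial.smult (sqrt (2 * real k + 1)) (\<Sum>i\<le>k. Polynomial.smult ((-1)^(k+i) * real (k choose i) * real (k choose i)) (q i))"
  have dp: "degree p \<le> k" unfolding p_def
    by (intro order.trans[OF degree_smult_le] degree_sum_le) (auto simp: dq)
  have pp: "poly p t = legendre k t" for t
    unfolding p_def legendre_def Bernstein_def q_def by (simp add: poly_sum mult_ac)
  have "coeff p k = sqrt (2 * real k + 1) * (\<Sum>i\<le>k. (real (k choose i))^2)"
  proof -
    have "(-1)^(k+i) * real (k choose i) * real (k choose i) * coeff (q i) k = (real (k choose i))^2" if "i \<le> k" for i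
    proof -
      have "(-1::real)^(k+i) * (-1)^(k-i) = 1" using that by (simp flip: power_add)
      then show ?thesis using lq[OF that] by (simp add: power2_eq_square mult_ac)
    qed
    then show ?thesis unfolding p_def by (simp add: coeff_sum)
  qed
  moreover have "(\<Sum>i\<le>k. (real (k choose i))^2) > 0"
    by (intro sum_pos) auto
  ultimately have "coeff p k \<noteq> 0" by (smt (verit) mult_eq_0_iff real_sqrt_eq_zero_cancel_iff of_nat_0_le_iff)
  moreover have "legendre k t = (\<Sum>i\<le>k. coeff p i * t^i)" for t
    
  proof -
    have "legendre k t = (\<Sum>i\<le>degree p. coeff p i * t^i)" unfolding pp[symmetric] by (rule poly_altdef)
    also have "\<dots> = (\<Sum>i\<le>k. coeff p i * t^i)"
      using dp by (intro sum.mono_neutral_left) (auto simp: coeff_eq_0)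
    finally show ?thesis .
  qed
  ultimately show thesis using that by blast
qed

lemma matvec_sum: 
  fixes A :: "real mat"
  assumes "A \<in> carrier_mat (m+1) (m+1)" "c \<in> carrier_vec (m+1)" "i \<le> m"
  shows "(A *\<^sub>v c) $ i = (\<Sum>k\<le>m. A $$ (i,k) * c $ k)"
proof -
  have "(A *\<^sub>v c) $ i = (\<Sum>k\<in>{0..<m+1}. A $$ (i,k) * c $ k)"
    using assms by (simp add: scalar_prod_def)
  then show ?thesis by (simp add: atLeast0LessThan lessThan_Suc_atMost)
qed

lemma mat_eq_by_vec:
  fixes A B :: "real mat"
  assumes A: "A \<in> carrier_mat n n" and B: "B \<in> carrier_mat n n"
    and e: "\<And>c. c \<in> carrier_vec n \<Longrightarrow> A *\<^sub>v c = B *\<^sub>v c"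
  shows "A = B"
proof (rule eq_matI)
  fix i j assume "i < dim_row B" "j < dim_col B"
  then have ij: "i < n" "j < n" using B by auto
  have "(A *\<^sub>v unit_vec n j) $ i = (B *\<^sub>v unit_vec n j) $ i" using e by simp
  then show "A $$ (i,j) = B $$ (i,j)" using A B ij by simp
qed (use A B in auto)

lemma is_legendre_bernstein_mat_unique_ex: "\<exists>!M. is_legendre_bernstein_mat m M"
proof -
  have "\<exists>a. (\<forall>t. legendre k t = (\<Sum>i\<le>k. a i * t^i)) \<and> a k \<noteq> 0" for k
    by (rule legendre_monom[of k]) blast
  then obtain a where a: "\<And>k t. legendre k t = (\<Sum>i\<le>k. a k i * t^i)" "\<And>k. a k k \<noteq> 0"
    by metis
  define A where "A = mat (m+1) (m+1) (\<lambda>(i,k). if i \<le> k then a k i else 0)"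
  define B where "B = mat (m+1) (m+1) (\<lambda>(j,k). real (j choose k) / real (m choose k))"
  have cA: "A \<in> carrier_mat (m+1) (m+1)" and cB: "B \<in> carrier_mat (m+1) (m+1)"
    unfolding A_def B_def by auto
  define M where "M = B * A"
  have cM: "M \<in> carrier_mat (m+1) (m+1)" unfolding M_def using cA cB by auto
  have "det A = prod_list (diag_mat A)"
    by (rule det_upper_triangular[OF _ cA]) (auto simp: A_def upper_triangular_def)
  also have "\<dots> \<noteq> 0" using a(2) by (auto simp: prod_list_diag_prod A_def)
  finally have dA: "det A \<noteq> 0" .
  have "det B = prod_list (diag_mat B)"
    by (rule det_lower_triangular[OF _ cB]) (auto simp: B_def)
  also have "\<dots> \<noteq> 0" by (auto simp: prod_list_diag_prod B_def)
  finally have dB: "det B \<noteq> 0" .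
  have "det M \<noteq> 0" unfolding M_def using det_mult[OF cB cA] dA dB by simp
  from det_non_zero_imp_unit[OF cM this, where b="()"]
  have inv: "invertible_mat M"
    using cM unfolding Units_def ring_mat_simps invertible_mat_def inverts_mat_def by auto
  have conv: "legendre_sum m c t = bernstein_sum m (M *\<^sub>v c) t"
    if c: "c \<in> carrier_vec (m+1)" for c and t :: real
  proof -
    have Ac: "A *\<^sub>v c \<in> carrier_vec (m+1)" using cA c by simp
    have leg: "legendre k t = (\<Sum>i\<le>m. A $$ (i,k) * t^i)" if "k \<le> m" for k
    proof -
      have "(\<Sum>i\<le>m. A $$ (i,k) * t^i) = (\<Sum>i\<le>k. A $$ (i,k) * t^i)"
        using that by (intro sum.mono_neutral_right) (auto simp: A_def)
      also have "\<dots> = legendre k t" unfolding a(1) using that by (intro sum.cong) (auto simp: A_def)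
      finally show ?thesis by simp
    qed
    have "legendre_sum m c t = (\<Sum>k\<le>m. \<Sum>i\<le>m. A $$ (i,k) * t^i * c $ k)"
      unfolding legendre_sum_def by (intro sum.cong) (auto simp: leg sum_distrib_right)
    also have "\<dots> = (\<Sum>i\<le>m. \<Sum>k\<le>m. A $$ (i,k) * t^i * c $ k)" by (rule sum.swap)
    also have "\<dots> = (\<Sum>i\<le>m. (A *\<^sub>v c) $ i * t^i)"
      by (intro sum.cong refl) (auto simp: matvec_sum[OF cA c] sum_distrib_left mult_ac)
    also have "\<dots> = (\<Sum>i\<le>m. \<Sum>j\<le>m. B $$ (j,i) * (A *\<^sub>v c) $ i * Bernstein m j t)"
    proof (intro sum.cong refl)
      fix i assume "i \<in> {..m}"
      then have i: "i \<le> m" by simp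
      show "(A *\<^sub>v c) $ i * t^i = (\<Sum>j\<le>m. B $$ (j,i) * (A *\<^sub>v c) $ i * Bernstein m j t)"
        unfolding power_bern[OF i, of t] sum_distrib_left using i
        by (intro sum.cong refl) (auto simp: B_def)
    qed
    also have "\<dots> = (\<Sum>j\<le>m. \<Sum>i\<le>m. B $$ (j,i) * (A *\<^sub>v c) $ i * Bernstein m j t)" by (rule sum.swap)
    also have "\<dots> = (\<Sum>j\<le>m. (B *\<^sub>v (A *\<^sub>v c)) $ j * Bernstein m j t)"
    proof (intro sum.cong refl)
      fix j assume "j \<in> {..m}"
      then have j: "j \<le> m" by simp
      show "(\<Sum>i\<le>m. B $$ (j,i) * (A *\<^sub>v c) $ i * Bernstein m j t) = (B *\<^sub>v (A *\<^sub>v c)) $ j * Bernstein m j t"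
        unfolding matvec_sum[OF cB Ac j] sum_distrib_right ..
    qed
    also have "B *\<^sub>v (A *\<^sub>v c) = M *\<^sub>v c"
      unfolding M_def using assoc_mult_mat_vec[OF cB cA c] by simp
    finally show ?thesis unfolding bernstein_sum_def by (simp add: mult_ac)
  qed
  have "is_legendre_bernstein_mat m M"
    unfolding is_legendre_bernstein_mat_def
  proof (intro conjI ballI impI cM inv)
    fix c d :: "real vec"
    assume c: "c \<in> carrier_vec (m+1)" and d: "d \<in> carrier_vec (m+1)"
      and e: "\<forall>t. legendre_sum m c t = bernstein_sum m d t"
    have "(\<Sum>j\<le>m. (d $ j - (M *\<^sub>v c) $ j) * Bernstein m j t) = 0" for t
      using e conv[OF c, of t] unfolding bernstein_sum_def left_diff_distrib sum_subtractf
      by (simp add: mult_ac)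
    from bern_indep[OF this] have "d $ j = (M *\<^sub>v c) $ j" if "j \<le> m" for j
      using that by force
    then show "d = M *\<^sub>v c" using d cM by (intro eq_vecI) auto
  qed
  moreover have "N = M" if N: "is_legendre_bernstein_mat m N" for N
  proof (rule mat_eq_by_vec)
    show "N \<in> carrier_mat (m+1) (m+1)" using N unfolding is_legendre_bernstein_mat_def by blast
    show "N *\<^sub>v c = M *\<^sub>v c" if c: "c \<in> carrier_vec (m+1)" for c
    proof -
      have "M *\<^sub>v c \<in> carrier_vec (m+1)" using cM c by simp
      then show ?thesis using N c conv[OF c] unfolding is_legendre_bernstein_mat_def by metis
    qed
  qed (rule cM)
  ultimately show ?thesis by blast
qed

definition legendre_bernstein_mat :: "nat \<Rightarrow> real mat" where
  "legendre_bernstein_mat m = (THE M. is_legendre_bernstein_mat m M)"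

lemma legendre_bernstein_mat: "is_legendre_bernstein_mat m (legendre_bernstein_mat m)"
  unfolding legendre_bernstein_mat_def
  by (rule theI'[OF is_legendre_bernstein_mat_unique_ex])

text \<open>The library's \<^const>\<open>mat_inverse\<close> yields \<^const>\<open>None\<close> exactly for singular matrices.\<close>

definition G_mat :: "nat \<Rightarrow> real mat" where
  "G_mat m = (let N = the (mat_inverse (legendre_bernstein_mat m)) in transpose_mat N * N)"

text \<open>Only parameters \<open>t \<ge> 0\<close> are meaningful: the integral over an empty interval is \<open>0\<close>.\<close>

definition preimage_curve :: "(real \<Rightarrow> complex) \<Rightarrow> real \<Rightarrow> complex" where
  "preimage_curve w t = integral {0..t} (\<lambda>\<tau>. (w \<tau>)\<^sup>2)"

definition vec_norm2 :: "real vec \<Rightarrow> real" where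
  "vec_norm2 v = L2_set (\<lambda>i. v $ i) {..<dim_vec v}"

definition complex_vec :: "real vec \<Rightarrow> real vec \<Rightarrow> complex vec" where
  "complex_vec x y = map_vec complex_of_real x + \<i> \<cdot>\<^sub>v map_vec complex_of_real y"

end

theory Submission
  imports Defs
begin

text \<open>Everything reduces to one identity: for a Legendre coefficient vector \<open>C\<close>, the endpoint
  \<open>\<integral>\<^sub>0\<^sup>1 w\<^sup>2\<close> equals the bilinear (not Hermitian) square \<open>C \<bullet> C\<close>. This is orthonormality of the
  Legendre basis, applied after expanding the square
  (\<open>preimage_curve_legendre_sum\<close>). The four equivalent conditions are then four ways to write
  \<open>C \<bullet> C = 1\<close>: as a sum of squares, by real and imaginary parts
  (\<open>scalar_prod_complex_vec\<close>), and in Bernstein coordinates, where \<open>C = M\<^sup>-\<^sup>1 W\<close> turns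
  \<open>C \<bullet> C\<close> into the quadratic form of \<open>(M\<^sup>-\<^sup>1)\<^sup>T M\<^sup>-\<^sup>1\<close> (\<open>scalar_prod_G_mat\<close>). For the
  perturbation, \<open>w + \<delta>w\<close> has coefficients \<open>C + \<delta>C\<close>, and
  \<open>(C + \<delta>C) \<bullet> (C + \<delta>C) - C \<bullet> C = \<delta>C \<bullet> (\<delta>C + 2 C)\<close>.

  Orthonormality itself starts from the definition of \<open>L\<^sub>k\<close> in the Bernstein basis. Integrating
  \<open>L\<^sub>k t\<^sup>j\<close> term by term gives Beta integrals whose sum is, up to a factor, the \<open>k\<close>-th finite
  difference of the polynomial \<open>x \<mapsto> binom (x + j) j\<close> at \<open>0\<close>; it vanishes for \<open>j < k\<close> and is \<open>1\<close> for
  \<open>j = k\<close>. So \<open>L\<^sub>k\<close> is orthogonal to lower degrees, and pairing \<open>L\<^sub>k\<close> with itself only sees leading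
  coefficients: the summand \<open>t\<^sup>i (1 - t)\<^sup>k\<^sup>-\<^sup>i\<close> counts as \<open>(-1)\<^sup>k\<^sup>-\<^sup>i t\<^sup>k\<close>, the signs cancel, and
  the sum of squared binomial coefficients \<open>binom (2 k) k\<close> cancels the remaining factorials.\<close>

section \<open>Orthonormality of the Legendre basis\<close>

text \<open>The Beta integral at integer arguments. The function
  \<open>t\<^sup>a\<^sup>+\<^sup>1 (1 - t)\<^sup>b\<^sup>+\<^sup>1\<close> vanishes at both ends, so its derivative integrates to zero; this trades
  one factor \<open>1 - t\<close> for one factor \<open>t\<close>.\<close>
lemma has_integral_power_mult_power:
  "((\<lambda>t::real. t ^ a * (1 - t) ^ b) has_integral fact a * fact b / fact (a + b + 1)) {0..1}"
proof (induction b arbitrary: a)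
  case 0
  have "((\<lambda>t::real. t ^ a) has_integral (1 ^ Suc a / real (Suc a) - 0 ^ Suc a / real (Suc a))) {0..1}"
    by (rule fundamental_theorem_of_calculus)
       (auto intro!: derivative_eq_intros simp del: power_Suc of_nat_Suc
         simp flip: has_real_derivative_iff_has_vector_derivative)
  moreover have "1 ^ Suc a / real (Suc a) - 0 ^ Suc a / real (Suc a)
      = fact a * fact 0 / fact (a + 0 + 1)"
    by simp
  ultimately show ?case by simp
next
  case (Suc b)
  define F where "F t = t ^ Suc a * (1 - t) ^ Suc b / real (Suc a)" for t :: real
  have "((\<lambda>t. t ^ a * (1 - t) ^ Suc b
          - real (Suc b) / real (Suc a) * (t ^ Suc a * (1 - t) ^ b)) has_integral F 1 - F 0) {0..1}"
  proof (rule fundamental_theorem_of_calculus)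
    fix t :: real
    have "(F has_real_derivative (t ^ a * (1 - t) ^ Suc b
          - real (Suc b) / real (Suc a) * (t ^ Suc a * (1 - t) ^ b))) (at t within {0..1})"
      unfolding F_def
      apply (rule derivative_eq_intros refl | simp del: of_nat_Suc power_Suc)+
      by (simp add: divide_simps del: of_nat_Suc)
    then show "(F has_vector_derivative (t ^ a * (1 - t) ^ Suc b
          - real (Suc b) / real (Suc a) * (t ^ Suc a * (1 - t) ^ b))) (at t within {0..1})"
      by (simp only: has_real_derivative_iff_has_vector_derivative)
  qed simp
  from has_integral_add[OF this has_integral_mult_right[OF Suc[of "Suc a"],
        of "real (Suc b) / real (Suc a)"]]
  have "((\<lambda>t. t ^ a * (1 - t) ^ Suc b) has_integral
      F 1 - F 0 + real (Suc b) / real (Suc a) * (fact (Suc a) * fact b / fact (Suc a + b + 1)))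
      {0..1}"
    by simp
  moreover have "F 1 - F 0 + real (Suc b) / real (Suc a)
        * (fact (Suc a) * fact b / fact (Suc a + b + 1))
      = fact a * fact (Suc b) / fact (a + Suc b + 1)"
  proof -
    have coeff: "real (Suc b) / real (Suc a) * (fact (Suc a) * fact b)
        = fact a * (fact (Suc b) :: real)"
      by (simp add: fact_Suc divide_simps del: of_nat_Suc)
    have ends: "F 1 = 0" "F 0 = 0" unfolding F_def by auto
    have dim: "Suc a + b + 1 = a + Suc b + 1" by simp
    show ?thesis
      by (simp only: ends dim times_divide_eq_right coeff diff_self add_0)
  qed
  ultimately show ?case by (simp only:)
qed

text \<open>The alternating binomial sum is the \<open>k\<close>-th forward difference of \<open>f\<close> at \<open>0\<close>; this is its
  recursion, obtained from Pascal's rule.\<close>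
lemma alternating_binomial_sum_Suc:
  fixes f :: "nat \<Rightarrow> real"
  shows "(\<Sum>i\<le>Suc k. (-1) ^ (Suc k + i) * real (Suc k choose i) * f i)
    = (\<Sum>i\<le>k. (-1) ^ (k + i) * real (k choose i) * (f (Suc i) - f i))"
proof -
  let ?s = "\<lambda>i. (-1) ^ (k + i) * real (k choose i) * f i"
  have "(\<Sum>i\<le>Suc k. (-1) ^ (Suc k + i) * real (Suc k choose i) * f i)
      = - ?s 0 + (\<Sum>i\<le>k. (-1) ^ (k + i) * real (k choose i) * f (Suc i) - ?s (Suc i))"
    by (subst sum.atMost_Suc_shift) (simp add: algebra_simps)
  also have "\<dots> = (\<Sum>i\<le>k. (-1) ^ (k + i) * real (k choose i) * f (Suc i)) - (\<Sum>i\<le>Suc k. ?s i)"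
    using sum.atMost_Suc_shift[of ?s k] by (simp only: sum_subtractf)
  also have "(\<Sum>i\<le>Suc k. ?s i) = (\<Sum>i\<le>k. ?s i)" by simp
  finally show ?thesis by (simp add: sum_subtractf right_diff_distrib)
qed

text \<open>Pascal's rule says that one forward difference sends \<open>binom x j\<close> to \<open>binom x (j - 1)\<close>.\<close>
lemma alternating_binomial_sum_choose:
  "(\<Sum>i\<le>k. (-1) ^ (k + i) * real (k choose i) * real ((x + i) choose j))
    = (if k \<le> j then real (x choose (j - k)) else 0)"
proof (induction k arbitrary: j)
  case 0
  then show ?case by simp
next
  case (Suc k)
  show ?case
  proof (cases j)
    case 0
    have "real ((x + Suc i) choose 0) - real ((x + i) choose 0) = 0" for i
      by simp
    then show ?thesis unfolding alternating_binomial_sum_Suc 0 by simp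
  next
    case (Suc j')
    have "real ((x + Suc i) choose j) - real ((x + i) choose j) = real ((x + i) choose j')" for i
      by (simp add: Suc)
    then show ?thesis unfolding alternating_binomial_sum_Suc by (simp add: Suc.IH Suc)
  qed
qed

text \<open>For \<open>j < k\<close> the factor \<open>j choose k\<close> is zero, so this contains the orthogonality of \<open>L\<^sub>k\<close> to all
  polynomials of lower degree.\<close>
lemma has_integral_legendre_mult_power:
  "((\<lambda>t. legendre k t * t ^ j) has_integral
     sqrt (2 * real k + 1) * (fact k * fact j / fact (k + j + 1) * real (j choose k))) {0..1}"
proof -
  let ?g = "\<lambda>i. (-1) ^ (k + i) * (real (k choose i))\<^sup>2"
  have "((\<lambda>t. sqrt (2 * real k + 1) * (\<Sum>i\<le>k. ?g i * (t ^ (i + j) * (1 - t) ^ (k - i)))) has_integral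
      sqrt (2 * real k + 1) * (\<Sum>i\<le>k. ?g i * (fact (i + j) * fact (k - i) / fact ((i + j) + (k - i) + 1)))) {0..1}"
    by (intro has_integral_mult_right has_integral_sum has_integral_power_mult_power) simp
  moreover have "(\<lambda>t. sqrt (2 * real k + 1) * (\<Sum>i\<le>k. ?g i * (t ^ (i + j) * (1 - t) ^ (k - i))))
      = (\<lambda>t. legendre k t * t ^ j)"
    unfolding legendre_def Bernstein_def
    by (simp add: sum_distrib_left sum_distrib_right power_add power2_eq_square mult_ac)
  moreover have "(\<Sum>i\<le>k. ?g i * (fact (i + j) * fact (k - i) / fact ((i + j) + (k - i) + 1)))
      = fact k * fact j / fact (k + j + 1) * real (j choose k)"
  proof -
    have "(\<Sum>i\<le>k. ?g i * (fact (i + j) * fact (k - i) / fact ((i + j) + (k - i) + 1)))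
      = (\<Sum>i\<le>k. fact k * fact j / fact (k + j + 1)
            * ((-1) ^ (k + i) * real (k choose i) * real ((j + i) choose j)))"
    proof (rule sum.cong[OF refl])
      fix i assume "i \<in> {..k}"
      then have i: "i \<le> k" by simp
      \<comment> \<open>One of the two binomial factors turns the Beta integral into a binomial coefficient; the
        other one, with the sign, remains as the weight of the finite difference.\<close>
      have prod: "real (k choose i) * fact (k - i) * fact (i + j) = fact k * fact j * real ((j + i) choose j)"
        using i by (simp add: binomial_fact add.commute)
      have dim: "(i + j) + (k - i) + 1 = k + j + 1" using i by simp
      have "?g i * (fact (i + j) * fact (k - i) / fact ((i + j) + (k - i) + 1))
          = (-1) ^ (k + i) * real (k choose i)
            * (real (k choose i) * fact (k - i) * fact (i + j)) / fact ((i + j) + (k - i) + 1)"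
        by (simp add: power2_eq_square mult_ac del: fact_Suc)
      also have "\<dots> = (-1) ^ (k + i) * real (k choose i)
            * (fact k * fact j * real ((j + i) choose j)) / fact (k + j + 1)"
        unfolding prod dim ..
      finally show "?g i * (fact (i + j) * fact (k - i) / fact ((i + j) + (k - i) + 1))
          = fact k * fact j / fact (k + j + 1)
            * ((-1) ^ (k + i) * real (k choose i) * real ((j + i) choose j))"
        by (simp add: mult_ac del: fact_Suc)
    qed
    also have "\<dots> = fact k * fact j / fact (k + j + 1) * (if k \<le> j then real (j choose (j - k)) else 0)"
      by (simp only: sum_distrib_left[symmetric] alternating_binomial_sum_choose)
    also have "(if k \<le> j then real (j choose (j - k)) else 0) = real (j choose k)"
      by (auto simp: binomial_symmetric[of k j])
    finally show ?thesis .
  qed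
  ultimately show ?thesis by simp
qed

text \<open>Against \<open>L\<^sub>k\<close>, a polynomial of degree at most \<open>k\<close> counts only through its coefficient of
  \<open>t\<^sup>k\<close>, here \<open>(-1)\<^sup>n\<close> if \<open>a + n = k\<close>. The products \<open>t\<^sup>a (1 - t)\<^sup>n\<close> are the summands of the other
  Legendre factor in its Bernstein form.\<close>
lemma has_integral_legendre_mult_low_degree:
  assumes "a + n \<le> k"
  shows "((\<lambda>t. legendre k t * (t ^ a * (1 - t) ^ n)) has_integral
     (if a + n = k then (-1) ^ n * (sqrt (2 * real k + 1) * ((fact k)\<^sup>2 / fact (2 * k + 1))) else 0))
     {0..1}"
  using assms
proof (induction n arbitrary: a)
  case 0
  show ?case
  proof (cases "a = k")
    case True
    have "k + k + 1 = 2 * k + 1" by simp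
    from has_integral_legendre_mult_power[of k k, unfolded this] show ?thesis
      by (simp add: True power2_eq_square del: fact_Suc)
  next
    case False
    then show ?thesis
      using has_integral_legendre_mult_power[of k a] 0 by (simp add: binomial_eq_0)
  qed
next
  case (Suc n)
  \<comment> \<open>Split \<open>t\<^sup>a (1 - t)\<^sup>n\<^sup>+\<^sup>1 = t\<^sup>a (1 - t)\<^sup>n - t\<^sup>a\<^sup>+\<^sup>1 (1 - t)\<^sup>n\<close>; the first part has degree below \<open>k\<close>.\<close>
  have "((\<lambda>t. legendre k t * (t ^ a * (1 - t) ^ n)) has_integral 0) {0..1}"
    using Suc.IH[of a] Suc.prems by simp
  from has_integral_diff[OF this Suc.IH[of "Suc a"]] Suc.prems
  have "((\<lambda>t. legendre k t * (t ^ a * (1 - t) ^ n) - legendre k t * (t ^ Suc a * (1 - t) ^ n))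
      has_integral 0 - (if Suc a + n = k
        then (-1) ^ n * (sqrt (2 * real k + 1) * ((fact k)\<^sup>2 / fact (2 * k + 1))) else 0)) {0..1}"
    by simp
  moreover have "legendre k t * (t ^ a * (1 - t) ^ n) - legendre k t * (t ^ Suc a * (1 - t) ^ n)
      = legendre k t * (t ^ a * (1 - t) ^ Suc n)" for t
    by (simp add: algebra_simps)
  moreover have "0 - (if Suc a + n = k
        then (-1) ^ n * (sqrt (2 * real k + 1) * ((fact k)\<^sup>2 / fact (2 * k + 1))) else 0)
      = (if a + Suc n = k
        then (-1) ^ Suc n * (sqrt (2 * real k + 1) * ((fact k)\<^sup>2 / fact (2 * k + 1))) else 0)"
    by simp
  ultimately show ?case by (simp only:)
qed

lemma has_integral_legendre_mult_legendre:
  "((\<lambda>t. legendre j t * legendre k t) has_integral (if j = k then 1 else 0)) {0..1}"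
proof -
  have le: "((\<lambda>t. legendre k t * legendre l t) has_integral (if l = k then 1 else 0)) {0..1}"
    if "l \<le> k" for k l
  proof -
    let ?\<kappa> = "sqrt (2 * real k + 1) * ((fact k)\<^sup>2 / fact (2 * k + 1))"
    let ?g = "\<lambda>i. (-1) ^ (l + i) * (real (l choose i))\<^sup>2"
    let ?v = "\<lambda>i. if i + (l - i) = k then (-1) ^ (l - i) * ?\<kappa> else 0"
    have "((\<lambda>t. sqrt (2 * real l + 1) * (\<Sum>i\<le>l. ?g i * (legendre k t * (t ^ i * (1 - t) ^ (l - i)))))
        has_integral sqrt (2 * real l + 1) * (\<Sum>i\<le>l. ?g i * ?v i)) {0..1}"
      using that
      by (intro has_integral_mult_right has_integral_sum has_integral_legendre_mult_low_degree) auto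
    moreover have "sqrt (2 * real l + 1) * (\<Sum>i\<le>l. ?g i * (legendre k t * (t ^ i * (1 - t) ^ (l - i))))
        = legendre k t * legendre l t" for t
      by (simp add: legendre_def[of l] Bernstein_def sum_distrib_left power2_eq_square mult_ac)
    moreover have "sqrt (2 * real l + 1) * (\<Sum>i\<le>l. ?g i * ?v i) = (if l = k then 1 else 0)"
    proof (cases "l = k")
      case True
      have "(\<Sum>i\<le>l. ?g i * ?v i) = (\<Sum>i\<le>k. ?\<kappa> * real ((k choose i)\<^sup>2))"
      proof (rule sum.cong)
        fix i assume "i \<in> {..k}"
        then have "(-1) ^ (k + i) * (-1) ^ (k - i) = (1::real)" by (simp flip: power_add)
        then show "?g i * ?v i = ?\<kappa> * real ((k choose i)\<^sup>2)"
          using True \<open>i \<in> {..k}\<close> by (simp add: mult_ac del: fact_Suc)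
      qed (simp add: True)
      also have "\<dots> = ?\<kappa> * real (2 * k choose k)"
        by (simp only: sum_distrib_left[symmetric] of_nat_sum[symmetric] choose_square_sum)
      finally have "sqrt (2 * real l + 1) * (\<Sum>i\<le>l. ?g i * ?v i)
          = (2 * real k + 1) * ((fact k)\<^sup>2 / fact (2 * k + 1)) * real (2 * k choose k)"
        using True by (simp del: fact_Suc)
      also have "\<dots> = 1"
        by (simp add: binomial_fact power2_eq_square mult_2[symmetric] divide_simps)
      finally show ?thesis using True by simp
    next
      case False
      then show ?thesis using that by simp
    qed
    ultimately show ?thesis by simp
  qed
  show ?thesis
    using le[of j k] le[of k j] by (cases "j \<le> k") (auto simp: mult.commute)
qed

section \<open>The endpoint of the curve in Legendre coordinates\<close>

lemma sum_squared_double: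
  fixes v :: "nat \<Rightarrow> complex"
  shows "(\<Sum>k\<le>m. a k *\<^sub>R v k)\<^sup>2 = (\<Sum>j\<le>m. \<Sum>k\<le>m. (a j * a k) *\<^sub>R (v j * v k))"
  by (simp add: power2_eq_square sum_product mult_ac)

lemma preimage_curve_legendre_sum:
  fixes C :: "complex vec"
  assumes C: "C \<in> carrier_vec (m + 1)"
  shows "preimage_curve (legendre_sum m C) 1 = C \<bullet> C"
proof -
  have "((\<lambda>t. (legendre_sum m C t)\<^sup>2) has_integral
      (\<Sum>j\<le>m. \<Sum>k\<le>m. (if j = k then 1 else 0) *\<^sub>R (C $ j * C $ k))) {0..1}"
    unfolding legendre_sum_def sum_squared_double
    by (intro has_integral_sum has_integral_scaleR_left has_integral_legendre_mult_legendre) auto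
  moreover have "(\<Sum>j\<le>m. \<Sum>k\<le>m. (if j = k then 1 else 0) *\<^sub>R (C $ j * C $ k)) = C \<bullet> C"
    using C by (simp add: scalar_prod_def if_distrib[of "\<lambda>x. x *\<^sub>R _"] sum.delta
        atLeast0LessThan lessThan_Suc_atMost cong: if_cong)
  ultimately show ?thesis unfolding preimage_curve_def by (simp add: integral_unique)
qed

section \<open>Passing to Bernstein coordinates\<close>

text \<open>The conversion matrix is characterised by real coefficient vectors only. Both bases are real, so
  a complex identity splits into its real and imaginary parts.\<close>
lemma legendre_bernstein_sum_Re_Im:
  fixes C W :: "complex vec"
  assumes C: "C \<in> carrier_vec (m + 1)" and W: "W \<in> carrier_vec (m + 1)"
    and eq: "\<And>t. legendre_sum m C t = bernstein_sum m W t"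
  shows "map_vec Re W = legendre_bernstein_mat m *\<^sub>v map_vec Re C"
    and "map_vec Im W = legendre_bernstein_mat m *\<^sub>v map_vec Im C"
proof -
  have conv: "d = legendre_bernstein_mat m *\<^sub>v c"
    if "c \<in> carrier_vec (m + 1)" "d \<in> carrier_vec (m + 1)"
      "\<And>t. legendre_sum m c t = bernstein_sum m d t" for c d
    using legendre_bernstein_mat[of m] that unfolding is_legendre_bernstein_mat_def by blast
  have sums: "legendre_sum m (map_vec Re C) t = Re (legendre_sum m C t)"
      "legendre_sum m (map_vec Im C) t = Im (legendre_sum m C t)"
      "bernstein_sum m (map_vec Re W) t = Re (bernstein_sum m W t)"
      "bernstein_sum m (map_vec Im W) t = Im (bernstein_sum m W t)" for t
    using C W by (simp_all add: legendre_sum_def bernstein_sum_def)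
  show "map_vec Re W = legendre_bernstein_mat m *\<^sub>v map_vec Re C"
    by (rule conv) (use C W in \<open>simp_all add: sums eq\<close>)
  show "map_vec Im W = legendre_bernstein_mat m *\<^sub>v map_vec Im C"
    by (rule conv) (use C W in \<open>simp_all add: sums eq\<close>)
qed

definition bernstein_legendre_mat :: "nat \<Rightarrow> real mat" where
  "bernstein_legendre_mat m = the (mat_inverse (legendre_bernstein_mat m))"

lemma bernstein_legendre_mat:
  shows bernstein_legendre_mat_carrier: "bernstein_legendre_mat m \<in> carrier_mat (m + 1) (m + 1)"
    and bernstein_legendre_mat_mult: "bernstein_legendre_mat m * legendre_bernstein_mat m = 1\<^sub>m (m + 1)"
proof -
  let ?M = "legendre_bernstein_mat m"
  have M: "?M \<in> carrier_mat (m + 1) (m + 1)" and inv: "invertible_mat ?M"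
    using legendre_bernstein_mat[of m] unfolding is_legendre_bernstein_mat_def by auto
  from inv obtain B where B: "?M * B = 1\<^sub>m (m + 1)" "B * ?M = 1\<^sub>m (dim_row B)"
    using M unfolding invertible_mat_def inverts_mat_def by auto
  have "dim_row B = m + 1" using arg_cong[OF B(2), of dim_col] M by simp
  moreover have "dim_col B = m + 1" using arg_cong[OF B(1), of dim_col] by simp
  ultimately have "?M \<in> Units (ring_mat TYPE(real) (m + 1) ())"
    using B M unfolding Units_def ring_mat_simps by auto
  then obtain N where "mat_inverse ?M = Some N"
    using mat_inverse(1)[OF M, where b = "()"] by auto
  then show "bernstein_legendre_mat m \<in> carrier_mat (m + 1) (m + 1)"
    "bernstein_legendre_mat m * ?M = 1\<^sub>m (m + 1)"
    using mat_inverse(2)[OF M] unfolding bernstein_legendre_mat_def by auto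
qed

lemma legendre_coefficients_of_bernstein:
  fixes C W :: "complex vec"
  assumes C: "C \<in> carrier_vec (m + 1)" and W: "W \<in> carrier_vec (m + 1)"
    and eq: "\<And>t. legendre_sum m C t = bernstein_sum m W t"
  shows "map_mat complex_of_real (bernstein_legendre_mat m) *\<^sub>v W = C"
proof -
  let ?M = "legendre_bernstein_mat m" and ?N = "bernstein_legendre_mat m"
  note N = bernstein_legendre_mat_carrier[of m]
  have M: "?M \<in> carrier_mat (m + 1) (m + 1)"
    using legendre_bernstein_mat[of m] unfolding is_legendre_bernstein_mat_def by auto
  have inv: "?N *\<^sub>v (?M *\<^sub>v c) = c" if "c \<in> carrier_vec (m + 1)" for c
    using assoc_mult_mat_vec[OF N M that] bernstein_legendre_mat_mult[of m] that by simp
  have Re: "?N *\<^sub>v map_vec Re W = map_vec Re C"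
    using legendre_bernstein_sum_Re_Im(1)[OF C W eq] inv[of "map_vec Re C"] C by simp
  have Im: "?N *\<^sub>v map_vec Im W = map_vec Im C"
    using legendre_bernstein_sum_Re_Im(2)[OF C W eq] inv[of "map_vec Im C"] C by simp
  show ?thesis
  proof (rule eq_vecI)
    fix i assume "i < dim_vec C"
    then have i: "i < m + 1" using C by simp
    have "Re ((map_mat complex_of_real ?N *\<^sub>v W) $ i) = (?N *\<^sub>v map_vec Re W) $ i"
      using i N W by (simp add: scalar_prod_def)
    moreover have "Im ((map_mat complex_of_real ?N *\<^sub>v W) $ i) = (?N *\<^sub>v map_vec Im W) $ i"
      using i N W by (simp add: scalar_prod_def)
    ultimately show "(map_mat complex_of_real ?N *\<^sub>v W) $ i = C $ i"
      unfolding Re Im using i C by (simp add: complex_eq_iff)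
  qed (use C N in simp)
qed

text \<open>The form is stated for two vectors because the perturbation condition pairs \<open>\<delta>W\<close> with
  \<open>\<delta>W + 2 W\<close>.\<close>
lemma scalar_prod_G_mat:
  fixes U V :: "complex vec"
  assumes U: "U \<in> carrier_vec (m + 1)" and V: "V \<in> carrier_vec (m + 1)"
  defines "N \<equiv> map_mat complex_of_real (bernstein_legendre_mat m)"
  shows "V \<bullet> (map_mat complex_of_real (G_mat m) *\<^sub>v U) = (N *\<^sub>v V) \<bullet> (N *\<^sub>v U)"
proof -
  note B = bernstein_legendre_mat_carrier[of m]
  have N: "N \<in> carrier_mat (m + 1) (m + 1)" using B by (simp add: N_def)
  have "map_mat complex_of_real (G_mat m) = transpose_mat N * N"
    using B by (intro eq_matI)
      (auto simp: G_mat_def Let_def bernstein_legendre_mat_def[symmetric] N_def scalar_prod_def)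
  then have "V \<bullet> (map_mat complex_of_real (G_mat m) *\<^sub>v U)
      = V \<bullet> (transpose_mat N *\<^sub>v (N *\<^sub>v U))"
    using N U by simp
  also have "\<dots> = (transpose_mat N *\<^sub>v (N *\<^sub>v U)) \<bullet> V"
    using N U V by (intro comm_scalar_prod[of _ "m + 1"]) auto
  also have "\<dots> = (N *\<^sub>v U) \<bullet> (N *\<^sub>v V)"
    using N U V by (intro transpose_vec_mult_scalar) auto
  also have "\<dots> = (N *\<^sub>v V) \<bullet> (N *\<^sub>v U)"
    using N U V by (intro comm_scalar_prod[of _ "m + 1"]) auto
  finally show ?thesis .
qed

section \<open>Scalar products of complex vectors\<close>

lemma scalar_prod_complex_vec:
  assumes "a \<in> carrier_vec n" "b \<in> carrier_vec n" "c \<in> carrier_vec n" "d \<in> carrier_vec n"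
  shows "complex_vec a b \<bullet> complex_vec c d = Complex (a \<bullet> c - b \<bullet> d) (a \<bullet> d + b \<bullet> c)"
  using assms
  by (simp add: complex_eq_iff complex_vec_def scalar_prod_def sum_subtractf sum.distrib
      algebra_simps)

lemma vec_norm2_squared: "(vec_norm2 v)\<^sup>2 = v \<bullet> v"
  by (simp add: vec_norm2_def L2_set_def sum_nonneg scalar_prod_def power2_eq_square
      atLeast0LessThan)

lemma scalar_prod_add_self:
  fixes x y :: "complex vec"
  assumes "x \<in> carrier_vec n" "y \<in> carrier_vec n"
  shows "(x + y) \<bullet> (x + y) = x \<bullet> x + y \<bullet> (y + 2 \<cdot>\<^sub>v x)"
  using assms
  by (simp add: scalar_prod_def sum.distrib sum_distrib_left algebra_simps)

section \<open>The closure conditions\<close>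

theorem mainTheorem2:
  fixes m :: nat
    and w r :: "real \<Rightarrow> complex"
    and C W :: "complex vec"
    and C\<^sub>R C\<^sub>I :: "real vec"
    and G :: "complex mat"
  assumes C: "C \<in> carrier_vec (m + 1)"
    and W: "W \<in> carrier_vec (m + 1)"
    and w_legendre: "\<And>t. w t = legendre_sum m C t"
    and w_bernstein: "\<And>t. w t = bernstein_sum m W t"
    and C\<^sub>R: "C\<^sub>R \<in> carrier_vec (m + 1)"
    and C\<^sub>I: "C\<^sub>I \<in> carrier_vec (m + 1)"
    and C_split: "C = complex_vec C\<^sub>R C\<^sub>I"
    and r: "r = preimage_curve w"
    and G: "G = map_mat complex_of_real (G_mat m)"
  shows "(r 1 = 1 \<longleftrightarrow> (\<Sum>k\<le>m. (C $ k)\<^sup>2) = 1) \<and>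
    (r 1 = 1 \<longleftrightarrow> (vec_norm2 C\<^sub>R)\<^sup>2 - (vec_norm2 C\<^sub>I)\<^sup>2 = 1 \<and> C\<^sub>R \<bullet> C\<^sub>I = 0) \<and>
    (r 1 = 1 \<longleftrightarrow> W \<bullet> (G *\<^sub>v W) = 1) \<and>
    (r 1 = 1 \<longrightarrow>
      (\<forall>\<delta>w. \<forall>\<delta>C \<in> carrier_vec (m + 1). \<forall>\<delta>W \<in> carrier_vec (m + 1).
       \<forall>\<delta>C\<^sub>R \<in> carrier_vec (m + 1). \<forall>\<delta>C\<^sub>I \<in> carrier_vec (m + 1).
        (\<forall>t. \<delta>w t = legendre_sum m \<delta>C t) \<and>
        (\<forall>t. \<delta>w t = bernstein_sum m \<delta>W t) \<and>
        \<delta>C = complex_vec \<delta>C\<^sub>R \<delta>C\<^sub>I \<longrightarrow>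
        (let r' = preimage_curve (\<lambda>\<tau>. w \<tau> + \<delta>w \<tau>) in
          (r' 1 = 1 \<longleftrightarrow> \<delta>C \<bullet> (\<delta>C + 2 \<cdot>\<^sub>v C) = 0) \<and>
          (r' 1 = 1 \<longleftrightarrow> \<delta>W \<bullet> (G *\<^sub>v (\<delta>W + 2 \<cdot>\<^sub>v W)) = 0) \<and>
          (r' 1 = 1 \<longleftrightarrow>
             (vec_norm2 \<delta>C\<^sub>R)\<^sup>2 - (vec_norm2 \<delta>C\<^sub>I)\<^sup>2
               + 2 * (\<delta>C\<^sub>R \<bullet> C\<^sub>R) - 2 * (\<delta>C\<^sub>I \<bullet> C\<^sub>I) = 0 \<and>
             \<delta>C\<^sub>R \<bullet> \<delta>C\<^sub>I + \<delta>C\<^sub>R \<bullet> C\<^sub>I + \<delta>C\<^sub>I \<bullet> C\<^sub>R = 0))))"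
proof -
  let ?N = "map_mat complex_of_real (bernstein_legendre_mat m)"
  have w: "w = legendre_sum m C" using w_legendre by auto
  have r1: "r 1 = C \<bullet> C" unfolding r w by (rule preimage_curve_legendre_sum[OF C])
  have N: "?N \<in> carrier_mat (m + 1) (m + 1)" using bernstein_legendre_mat_carrier by simp
  have NW: "?N *\<^sub>v W = C"
    using C W w_legendre w_bernstein by (intro legendre_coefficients_of_bernstein) auto
  have b: "(\<Sum>k\<le>m. (C $ k)\<^sup>2) = C \<bullet> C"
    using C by (simp add: scalar_prod_def power2_eq_square atLeast0LessThan lessThan_Suc_atMost)
  have c: "C \<bullet> C = Complex ((vec_norm2 C\<^sub>R)\<^sup>2 - (vec_norm2 C\<^sub>I)\<^sup>2) (2 * (C\<^sub>R \<bullet> C\<^sub>I))"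
    using comm_scalar_prod[OF C\<^sub>R C\<^sub>I]
    by (simp add: C_split scalar_prod_complex_vec[OF C\<^sub>R C\<^sub>I C\<^sub>R C\<^sub>I] vec_norm2_squared)
  have d: "W \<bullet> (G *\<^sub>v W) = C \<bullet> C"
    unfolding G scalar_prod_G_mat[OF W W] NW ..
  have perturbed: "let r' = preimage_curve (\<lambda>\<tau>. w \<tau> + \<delta>w \<tau>) in
      (r' 1 = 1 \<longleftrightarrow> \<delta>C \<bullet> (\<delta>C + 2 \<cdot>\<^sub>v C) = 0) \<and>
      (r' 1 = 1 \<longleftrightarrow> \<delta>W \<bullet> (G *\<^sub>v (\<delta>W + 2 \<cdot>\<^sub>v W)) = 0) \<and>
      (r' 1 = 1 \<longleftrightarrow>
         (vec_norm2 \<delta>C\<^sub>R)\<^sup>2 - (vec_norm2 \<delta>C\<^sub>I)\<^sup>2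
           + 2 * (\<delta>C\<^sub>R \<bullet> C\<^sub>R) - 2 * (\<delta>C\<^sub>I \<bullet> C\<^sub>I) = 0 \<and>
         \<delta>C\<^sub>R \<bullet> \<delta>C\<^sub>I + \<delta>C\<^sub>R \<bullet> C\<^sub>I + \<delta>C\<^sub>I \<bullet> C\<^sub>R = 0)"
    if closed: "r 1 = 1"
      and \<delta>C: "\<delta>C \<in> carrier_vec (m + 1)" and \<delta>W: "\<delta>W \<in> carrier_vec (m + 1)"
      and \<delta>C\<^sub>R: "\<delta>C\<^sub>R \<in> carrier_vec (m + 1)" and \<delta>C\<^sub>I: "\<delta>C\<^sub>I \<in> carrier_vec (m + 1)"
      and legendre: "\<forall>t. \<delta>w t = legendre_sum m \<delta>C t"
      and bernstein: "\<forall>t. \<delta>w t = bernstein_sum m \<delta>W t"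
      and split: "\<delta>C = complex_vec \<delta>C\<^sub>R \<delta>C\<^sub>I"
    for \<delta>w \<delta>C \<delta>W \<delta>C\<^sub>R \<delta>C\<^sub>I
  proof -
    have "(\<lambda>\<tau>. w \<tau> + \<delta>w \<tau>) = legendre_sum m (C + \<delta>C)"
      using C \<delta>C legendre w_legendre
      by (auto simp: fun_eq_iff legendre_sum_def sum.distrib scaleR_add_right)
    then have "preimage_curve (\<lambda>\<tau>. w \<tau> + \<delta>w \<tau>) 1 = (C + \<delta>C) \<bullet> (C + \<delta>C)"
      using C \<delta>C by (simp add: preimage_curve_legendre_sum)
    then have iff: "preimage_curve (\<lambda>\<tau>. w \<tau> + \<delta>w \<tau>) 1 = 1 \<longleftrightarrow> \<delta>C \<bullet> (\<delta>C + 2 \<cdot>\<^sub>v C) = 0"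
      using closed r1 scalar_prod_add_self[OF C \<delta>C] by simp
    have N\<delta>W: "?N *\<^sub>v \<delta>W = \<delta>C"
      using \<delta>C \<delta>W legendre bernstein by (intro legendre_coefficients_of_bernstein) auto
    have "?N *\<^sub>v (\<delta>W + 2 \<cdot>\<^sub>v W) = \<delta>C + 2 \<cdot>\<^sub>v C"
      using mult_add_distrib_mat_vec[OF N \<delta>W, of "2 \<cdot>\<^sub>v W"] mult_mat_vec[OF N W] W NW N\<delta>W
      by simp
    then have G_form: "\<delta>W \<bullet> (G *\<^sub>v (\<delta>W + 2 \<cdot>\<^sub>v W)) = \<delta>C \<bullet> (\<delta>C + 2 \<cdot>\<^sub>v C)"
      using scalar_prod_G_mat[of "\<delta>W + 2 \<cdot>\<^sub>v W" m \<delta>W] W \<delta>W by (simp add: G N\<delta>W)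
    have "\<delta>C \<bullet> (\<delta>C + 2 \<cdot>\<^sub>v C) = \<delta>C \<bullet> \<delta>C + 2 * (\<delta>C \<bullet> C)"
      using C \<delta>C by (simp add: scalar_prod_add_distrib[of _ "m + 1"])
    also have "\<dots> = Complex
        ((vec_norm2 \<delta>C\<^sub>R)\<^sup>2 - (vec_norm2 \<delta>C\<^sub>I)\<^sup>2 + 2 * (\<delta>C\<^sub>R \<bullet> C\<^sub>R) - 2 * (\<delta>C\<^sub>I \<bullet> C\<^sub>I))
        (2 * (\<delta>C\<^sub>R \<bullet> \<delta>C\<^sub>I + \<delta>C\<^sub>R \<bullet> C\<^sub>I + \<delta>C\<^sub>I \<bullet> C\<^sub>R))"
      using comm_scalar_prod[OF \<delta>C\<^sub>R \<delta>C\<^sub>I]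
      by (simp add: split C_split vec_norm2_squared complex_eq_iff
          scalar_prod_complex_vec[OF \<delta>C\<^sub>R \<delta>C\<^sub>I \<delta>C\<^sub>R \<delta>C\<^sub>I] scalar_prod_complex_vec[OF \<delta>C\<^sub>R \<delta>C\<^sub>I C\<^sub>R C\<^sub>I])
    finally have "\<delta>C \<bullet> (\<delta>C + 2 \<cdot>\<^sub>v C) = 0 \<longleftrightarrow>
        (vec_norm2 \<delta>C\<^sub>R)\<^sup>2 - (vec_norm2 \<delta>C\<^sub>I)\<^sup>2 + 2 * (\<delta>C\<^sub>R \<bullet> C\<^sub>R) - 2 * (\<delta>C\<^sub>I \<bullet> C\<^sub>I) = 0 \<and>
        \<delta>C\<^sub>R \<bullet> \<delta>C\<^sub>I + \<delta>C\<^sub>R \<bullet> C\<^sub>I + \<delta>C\<^sub>I \<bullet> C\<^sub>R = 0"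
      by (simp add: complex_eq_iff del: distrib_left_numeral)
    then show ?thesis
      unfolding Let_def iff G_form by blast
  qed
  show ?thesis
  proof (intro conjI impI allI ballI)
    show "r 1 = 1 \<longleftrightarrow> (\<Sum>k\<le>m. (C $ k)\<^sup>2) = 1"
      using r1 b by simp
    show "r 1 = 1 \<longleftrightarrow> (vec_norm2 C\<^sub>R)\<^sup>2 - (vec_norm2 C\<^sub>I)\<^sup>2 = 1 \<and> C\<^sub>R \<bullet> C\<^sub>I = 0"
      using r1 c by (simp add: complex_eq_iff)
    show "r 1 = 1 \<longleftrightarrow> W \<bullet> (G *\<^sub>v W) = 1"
      using r1 d by simp
  qed (elim conjE, rule perturbed)
qed

end
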